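(* Let $p,q\in\mathbb{N}$ with $p<q$. (1) If $\Upsilon(p,q)\leqslant 3$ and $p/q\neq 10/17$, then $\mathcal{G}$ gives the unique best two-term underapproximation of $p/q$. (2) When $p/q=10/17$, $\mathcal{G}$ still gives the best (but not unique) two-term underapproximation of $p/q$. In particular, besides the underapproximation $1/2+1/12$ given by the greedy algorithm $\mathcal{G}$, there is exactly one other two-term underapproximation (up to the order of the two terms) equal to it, namely $1/3+1/4$. (3) Furthermore, for each integer $k\geqslant 4$, there exist $p,q\in\mathbb{N}$ with $p<q$ such that $\Upsilon(p,q)=k$ and $\mathcal{G}$ does not give the best two-term underapproximation of $p/q$.
   Context: $\mathbb{N}$ is the set of positive integers. For $p,q\in\mathbb{N}$, $\Upsilon(p,q)$ is the smallest positive integer $m$ such that $p$ divides $q+m$. For $\theta\in(0,1]$ let $G(\theta)=\lfloor 1/\theta\rfloor+1$. The greedy algorithm $\mathcal{G}$ produces the sequence $\mathcal{G}(\theta)=(a_n)_{n=1}^\infty$ defined by $a_1=G(\theta)$ and $a_m=G\left(\theta-\sum_{n=1}^{m-1}1/a_n\right)$ for $m\geqslant 2$. With $(a_n)_{n=1}^\infty=\mathcal{G}(\theta)$, $\mathcal{G}$ gives the best two-term underapproximation of $\theta$ if for all $x_1,x_2\in\mathbb{N}$ with $1/x_1+1/x_2<\theta$ we have $1/x_1+1/x_2\leqslant 1/a_1+1/a_2$ (note that always $1/a_1+1/a_2<\theta$). It is the unique best two-term underapproximation if, in addition, for positive integers $x_1\leqslant x_2$, $1/a_1+1/a_2\leqslant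 1/x_1+1/x_2<\theta$ implies $(x_1,x_2)=(a_1,a_2)$. *)

theory Defs
  imports Complex_Main
begin

definition Upsilon :: "nat \<Rightarrow> nat \<Rightarrow> nat" where
  "Upsilon p q = (LEAST m. 0 < m \<and> p dvd q + m)"

(* Meant for arguments in (0,1]; there 1 / theta > 0, so nat does not truncate. *)
definition G :: "real \<Rightarrow> nat" where
  "G \<theta> = nat \<lfloor>1 / \<theta>\<rfloor> + 1"

(* The sequence starts at index 1; the value at index 0 has no meaning. *)
function greedy :: "real \<Rightarrow> nat \<Rightarrow> nat" where
  "greedy \<theta> m = G (\<theta> - (\<Sum>n = 1..<m. 1 / real (greedy \<theta> n)))"
  by pat_completeness auto
termination
  by (relation "measure snd") auto

declare greedy.simps [simp del]

definition greedy_best_two_term :: "real \<Rightarrow> bool" where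
  "greedy_best_two_term \<theta> \<longleftrightarrow>
    (\<forall>x1 x2 :: nat. 0 < x1 \<and> 0 < x2 \<and> 1 / real x1 + 1 / real x2 < \<theta> \<longrightarrow>
      1 / real x1 + 1 / real x2 \<le> 1 / real (greedy \<theta> 1) + 1 / real (greedy \<theta> 2))"

definition greedy_unique_best_two_term :: "real \<Rightarrow> bool" where
  "greedy_unique_best_two_term \<theta> \<longleftrightarrow>
    greedy_best_two_term \<theta> \<and>
    (\<forall>x1 x2 :: nat. 0 < x1 \<and> x1 \<le> x2 \<and>
      1 / real (greedy \<theta> 1) + 1 / real (greedy \<theta> 2) \<le> 1 / real x1 + 1 / real x2 \<and>
      1 / real x1 + 1 / real x2 < \<theta> \<longrightarrow>
      (x1, x2) = (greedy \<theta> 1, greedy \<theta> 2))"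

end

theory Submission
  imports Defs "HOL-Computational_Algebra.Primes"
begin

text \<open>
  Write q + m = p a with m = \<Upsilon>(p,q), so that the greedy terms are a and b = \<lfloor>q a / m\<rfloor> + 1, and put
  r = m b - q a, which lies in {1, \<dots>, m}. A competitor x = a + d \<le> y with d > 0 that is at least as good
  has N = p x y - q (x + y) \<ge> 1. Comparing the two distances to p/q gives N a b \<le> r x y, and
  inserting the lower bound for 1/y turns this into N (a x + b d) \<le> r x x with d < a.
  If N \<ge> r, then b \<le> x < 2 a, which is impossible.
  If N < r \<le> 3, one may assume that m does not divide p. Then p a is bounded apart from the
  families m = r = 3, N = d = 1, p \<in> {4, 5}, which integrality of y excludes modulo 7 and 8;
  the finitely many remaining cases leave only 10/17.

  For part (3) with k \<ge> 12, the greedy value is beaten at every \<theta> in the interval (11/28, 19/48]: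
  there 1/4 + 1/7 = 11/28 is a better underapproximation, since a = 3 and b \<ge> 17. The fraction p / (3 p - k)
  lies in this interval when 19 k / 9 \<le> p < 11 k / 5.
\<close>

section \<open>Finite search and two congruences\<close>

text \<open>The ranges of \<open>p\<close> and \<open>a\<close> are the bounds derived in
  \<open>no_better_int\<close>; the exempt triple is 10/17. Every other candidate violates either
  the size inequality or the integrality of \<open>y = (q x + N) / (p x - q)\<close>.\<close>

lemma small_cases:
  "\<forall>m\<in>set [2..3::int]. \<forall>p\<in>set [3..19]. p mod m = 0 \<or>
    (\<forall>a\<in>set [2..27]. 27 < (p - 6) * a \<or> (m = 3 \<and> p = 10 \<and> a = 2) \<or>
      (let q = p * a - m; b = q * a div m + 1; r = m * b - q * a in
        \<forall>N\<in>set [1..r - 1]. \<forall>d\<in>set [1..a - 1]. let x = a + d in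
          r * x * x < N * (a * x + b * d) \<or> (q * x + N) mod (p * x - q) \<noteq> 0))"
  by code_simp

text \<open>For \<open>p = 4\<close>, \<open>m = 3\<close>, \<open>a = 3 c\<close>,
  \<open>x = a + 1\<close> and \<open>N = 1\<close>, this is the numerator \<open>q x + N\<close> of
  \<open>y\<close>, and 7 is the denominator \<open>p x - q\<close>.\<close>

lemma not_7_dvd: "\<not> 7 dvd 36 * (c * c) + 3 * c - (2::int)"
proof
  assume *: "7 dvd 36 * (c * c) + 3 * c - 2"
  define e f where "e = c div 7" and "f = c mod 7"
  have cef: "c = 7 * e + f" and f: "0 \<le> f" "f < 7" by (simp_all add: e_def f_def)
  have "36 * (c * c) + 3 * c - 2
      = 7 * (252 * (e * e) + 72 * (e * f) + 3 * e) + (36 * (f * f) + 3 * f - 2)"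
    unfolding cef by (simp add: algebra_simps)
  then have "7 dvd 36 * (f * f) + 3 * f - 2"
    using * by (metis dvd_add_right_iff dvd_triv_left)
  moreover have "f = 0 \<or> f = 1 \<or> f = 2 \<or> f = 3 \<or> f = 4 \<or> f = 5 \<or> f = 6"
    using f by linarith
  ultimately show False by auto
qed

text \<open>The same numerator for \<open>p = 5\<close>, where the denominator is 8.\<close>

lemma not_8_dvd: "\<not> 8 dvd 45 * (c * c) + 6 * c - (2::int)"
proof
  assume *: "8 dvd 45 * (c * c) + 6 * c - 2"
  \<comment> \<open>Residues modulo 4 suffice: after \<open>c = 4 e + f\<close> every term
    containing \<open>e\<close> is a multiple of 8.\<close>
  define e f where "e = c div 4" and "f = c mod 4"
  have cef: "c = 4 * e + f" and f: "0 \<le> f" "f < 4" by (simp_all add: e_def f_def)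
  have "45 * (c * c) + 6 * c - 2
      = 8 * (90 * (e * e) + 45 * (e * f) + 3 * e) + (45 * (f * f) + 6 * f - 2)"
    unfolding cef by (simp add: algebra_simps)
  then have "8 dvd 45 * (f * f) + 6 * f - 2"
    using * by (metis dvd_add_right_iff dvd_triv_left)
  moreover have "f = 0 \<or> f = 1 \<or> f = 2 \<or> f = 3"
    using f by linarith
  ultimately show False by auto
qed

section \<open>Competitors with a larger first term\<close>

text \<open>The last two hypotheses are \<open>1/x + 1/y < p/q\<close> and
  \<open>1/a + 1/b <= 1/x + 1/y\<close> cleared of denominators. A divisor \<open>m\<close> of
  \<open>p\<close> also divides \<open>q\<close>, so cancelling it leads back to
  \<open>m = 1\<close>. Integers keep all differences exact.\<close>

lemma no_better_int:
  fixes m p q a b x y :: int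
  assumes m: "1 \<le> m" "m \<le> 3" "m = 1 \<or> \<not> m dvd p" "m \<le> p"
    and q: "q = p * a - m" "p < q" and b: "b = q * a div m + 1"
    and xy: "a < x" "x \<le> y" "q * (x + y) < p * x * y" "x * y * (a + b) \<le> a * b * (x + y)"
  shows "m = 3 \<and> p = 10 \<and> a = 2"
proof (rule ccontr)
  assume not_exc: "\<not> ?thesis"
  have a: "2 \<le> a"
  proof (rule ccontr)
    assume "\<not> 2 \<le> a"
    then have "p * a \<le> p * 1" using m by (intro mult_left_mono) auto
    then show False using q m by linarith
  qed
  have p0: "0 < p" and q0: "0 < q" and x0: "0 < x" and y0: "0 < y"
    using m q a xy by linarith+
  \<comment> \<open>The two sums fall short of \<open>p/q\<close> by \<open>r / (q a b)\<close> and
    \<open>N / (q x y)\<close>.\<close>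
  define r where "r = m * b - q * a"
  define N where "N = p * x * y - q * (x + y)"
  define d where "d = x - a"
  have x: "x = a + d" by (simp add: d_def)
  have r: "1 \<le> r" "r \<le> m"
  proof -
    have "r = m - q * a mod m"
      unfolding r_def b by (simp add: algebra_simps minus_mod_eq_mult_div[symmetric])
    then show "1 \<le> r" "r \<le> m"
      using m(1) pos_mod_bound[of m "q * a"] pos_mod_sign[of m "q * a"] by linarith+
  qed
  have N: "1 \<le> N" using xy(3) by (simp add: N_def)
  have b0: "0 < b"
    unfolding b using q0 a m by (simp add: add_nonneg_pos pos_imp_zdiv_nonneg_iff)
  have d: "1 \<le> d" "d \<le> a - 1"
  proof -
    show "1 \<le> d" using xy d_def by simp
    \<comment> \<open>Since \<open>x <= y\<close>,
      \<open>2/x >= 1/x + 1/y >= 1/a + 1/b > 1/a\<close>, whence \<open>x < 2 a\<close>.\<close>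
    have "y * (x * (a + b)) \<le> a * b * (2 * y)"
      using order.trans[OF xy(4) mult_left_mono[of "x + y" "2 * y" "a * b"]] xy(2) a b0
      by (simp add: mult_ac)
    then have "y * (x * (a + b)) \<le> y * (2 * a * b)" by (simp add: mult_ac)
    then have "x * (a + b) \<le> 2 * a * b" using y0 by simp
    moreover have "x * b < x * (a + b)" using x0 a by simp
    ultimately have "x * b < (2 * a) * b" by linarith
    then have "x < 2 * a" using b0 by simp
    then show "d \<le> a - 1" by (simp add: d_def)
  qed
  have key: "N * (a * x + b * d) \<le> r * x * x"
  proof -
    have rab: "r = p * a * b - q * (a + b)" unfolding r_def q by (simp add: algebra_simps)
    have "r * x * y - N * (a * b) = q * (a * b * (x + y) - x * y * (a + b))"
      unfolding N_def rab by (simp add: algebra_simps)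
    moreover have "0 \<le> q * (a * b * (x + y) - x * y * (a + b))" using q0 xy(4) by simp
    ultimately have 1: "N * (a * b) \<le> r * x * y" by linarith
    \<comment> \<open>This is \<open>1/y >= 1/a + 1/b - 1/x\<close> cleared of denominators.\<close>
    have 2: "y * (a * x + b * d) \<le> x * (a * b)"
      using xy(4) unfolding d_def by (simp add: algebra_simps)
    have "0 \<le> a * x + b * d" using a x0 b0 d by simp
    then have "N * (a * b) * (a * x + b * d) \<le> r * x * y * (a * x + b * d)"
      using 1 by (rule mult_right_mono[rotated])
    also have "\<dots> = r * x * (y * (a * x + b * d))" by (simp add: mult_ac)
    also have "\<dots> \<le> r * x * (x * (a * b))" using 2 r x0 by (intro mult_left_mono) auto
    finally have "(a * b) * (N * (a * x + b * d)) \<le> (a * b) * (r * x * x)" by (simp add: mult_ac)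
    then show ?thesis using a b0 by simp
  qed
  \<comment> \<open>The definition of \<open>N\<close> solved for \<open>y\<close>: this keeps the
    integrality of \<open>y\<close> while eliminating \<open>y\<close> itself.\<close>
  have div: "(q * x + N) mod (p * x - q) = 0"
  proof -
    have "q * x + N = (p * x - q) * y" unfolding N_def by (simp add: algebra_simps)
    then show ?thesis by simp
  qed
  have mb: "m * b = q * a + r" by (simp add: r_def)
  have "N < r"
  proof (rule ccontr)
    assume "\<not> N < r"
    then have "r * (a * x + b * d) \<le> N * (a * x + b * d)"
      using a x0 b0 d by (intro mult_right_mono) auto
    also note key
    finally have "r * (a * x + b * d) \<le> r * (x * x)" by (simp add: mult_ac)
    then have "a * x + b * d \<le> x * x" using r by simp
    then have "b * d \<le> x * d" unfolding x by (simp add: algebra_simps)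
    then have bx: "b \<le> x" using d by simp
    then have "m * b \<le> m * (2 * a - 1)" using d m x by (intro mult_left_mono) auto
    then have "q * a < (2 * m) * a" using mb r m by (simp add: algebra_simps)
    then have "q < 2 * m" using a by simp
    then have pa: "p * a < 3 * m" using q by simp
    moreover have "m * a \<le> p * a" using m a by simp
    ultimately have "m * a < m * 3" by linarith
    then have "a = 2" using a m by simp
    \<comment> \<open>The survivor is \<open>p/q = 4/5\<close>, where \<open>b = 4\<close> but
      \<open>b <= x <= 3\<close>.\<close>
    then have "m = 3" "p = 4" using pa q m by auto
    then show False using \<open>a = 2\<close> bx b q d x by simp
  qed
  then have m': "m = 2 \<or> m = 3" using m r N by linarith
  then have "\<not> m dvd p" using m by auto
  \<comment> \<open>\<open>N >= 1\<close> and multiplication by \<open>m\<close> remove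
    \<open>N\<close> and \<open>b\<close> from \<open>key\<close>; \<open>bound'\<close> then
    replaces \<open>r\<close> by its maximum \<open>m\<close>.\<close>
  have bound: "(q * a + r) * d + m * a * x \<le> m * r * x * x"
  proof -
    have "a * x + b * d \<le> N * (a * x + b * d)"
      using mult_right_mono[OF N, of "a * x + b * d"] a x0 b0 d by simp
    then have "m * (a * x + b * d) \<le> m * (r * x * x)"
      using key m by (intro mult_left_mono) auto
    then show ?thesis unfolding mb[symmetric] by (simp add: algebra_simps)
  qed
  have "m * r * (x * x) \<le> m * m * (x * x)" using r m by (intro mult_right_mono mult_left_mono) auto
  then have bound': "(q * a) * d + m * a * x \<le> m * m * (x * x)"
    using bound r d mult_nonneg_nonneg[of r d] by (simp only: distrib_right mult.assoc) linarith
  have dd: "d * d \<le> a * d" "a * a \<le> a * a * d" "a \<le> a * d"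
    using d a by (simp_all add: mult_right_mono)
  have ad: "0 < a * d" using a d by simp
  have "27 < (p - 6) * a \<or> \<not> a \<le> 27 \<or> \<not> p \<le> 19"
  proof (rule ccontr)
    assume *: "\<not> ?thesis"
    have p3: "3 \<le> p" using m m' \<open>\<not> m dvd p\<close> by (cases "p = 2") auto
    have mem: "m \<in> set [2..3]" "p \<in> set [3..19]" "a \<in> set [2..27]"
        "N \<in> set [1..r - 1]" "d \<in> set [1..a - 1]"
      using m m' a * N \<open>N < r\<close> d p3 unfolding set_upto by auto
    have pm: "\<not> p mod m = 0" using \<open>\<not> m dvd p\<close> by (simp add: dvd_eq_mod_eq_0)
    have small: "\<not> 27 < (p - 6) * a" using * by simp
    note cases_a = bspec[OF bspec[OF small_cases mem(1)] mem(2), unfolded disj_imp, THEN mp, OF pm,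
        THEN bspec, OF mem(3), THEN mp, OF small, THEN mp, OF not_exc]
    note cases_d = cases_a[unfolded Let_def, folded q(1), folded b, folded r_def,
        THEN bspec, OF mem(4), THEN bspec, OF mem(5), folded x]
    have "\<not> r * x * x < N * (a * x + b * d)" using key by linarith
    from mp[OF cases_d this] show False using div by (rule notE)
  qed
  moreover have "(p - 6) * a \<le> 27 \<and> a \<le> 27 \<and> p \<le> 19" if m2: "m = 2"
  proof -
    have p: "3 \<le> p" using m2 m \<open>\<not> m dvd p\<close> by (cases "p = 2") auto
    have "p * a * a * d \<le> 2 * (a * a) + 8 * (a * d) + 4 * (d * d)"
      using bound' unfolding q(1) x m2 by (simp add: algebra_simps)
    \<comment> \<open>Estimating \<open>a a\<close> by \<open>a a d\<close> and \<open>d d\<close>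
      by \<open>a d\<close> makes \<open>a d\<close> a common factor, which is then
      cancelled.\<close>
    then have "(a * d) * (p * a) \<le> (a * d) * (2 * a + 12)"
      using dd by (simp add: algebra_simps)
    then have "p * a \<le> 2 * a + 12" using ad by (simp only: mult_le_cancel_left_pos)
    then have 2: "(p - 2) * a \<le> 12" by (simp add: algebra_simps)
    have "1 * a \<le> (p - 2) * a" "(p - 2) * 2 \<le> (p - 2) * a"
      using p a by (intro mult_right_mono mult_left_mono; simp)+
    then have "a \<le> 12" "(p - 2) * 2 \<le> 12" using 2 by linarith+
    moreover have "(p - 6) * a \<le> (p - 2) * a" using a by (intro mult_right_mono) auto
    then have "(p - 6) * a \<le> 12" using 2 by (rule order.trans)
    ultimately show ?thesis by auto
  qed
  moreover have "(p - 6) * a \<le> 27 \<and> a \<le> 27 \<and> p \<le> 19" if m3: "m = 3"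
  proof -
    have p: "4 \<le> p" "p \<noteq> 6" using m3 m \<open>\<not> m dvd p\<close> by (cases "p = 3"; auto)+
    have *: "p * a * a * d \<le> 6 * (a * a) + 27 * (a * d)"
      using bound' dd unfolding q(1) x m3 by (simp add: algebra_simps)
    then have "(a * d) * (p * a) \<le> (a * d) * (6 * a + 27)"
      using dd by (simp add: algebra_simps)
    then have "p * a \<le> 6 * a + 27" using ad by (simp only: mult_le_cancel_left_pos)
    then have 6: "(p - 6) * a \<le> 27" by (simp add: algebra_simps)
    have "a \<le> 27"
    proof (cases "7 \<le> p")
      case True
      then have "1 * a \<le> (p - 6) * a" using a by (intro mult_right_mono) auto
      then show ?thesis using 6 by linarith
    next
      case False
      \<comment> \<open>Now \<open>p\<close> is 4 or 5, so \<open>(p - 6) * a\<close> is negative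
        and its upper bound says nothing about \<open>a\<close>.\<close>
      show ?thesis
      proof (cases "d = 1")
        case False
        \<comment> \<open>With \<open>d >= 2\<close> the coefficient 6 of \<open>a a\<close> drops
          to 3, below \<open>p\<close>.\<close>
        then have "(a * a) * 2 \<le> (a * a) * d" using d by (intro mult_left_mono) auto
        then have "(a * d) * (p * a) \<le> (a * d) * (3 * a + 27)"
          using * by (simp add: algebra_simps)
        then have "p * a \<le> 3 * a + 27" using ad by (simp only: mult_le_cancel_left_pos)
        moreover have "4 * a \<le> p * a" using p a by (intro mult_right_mono) auto
        ultimately show ?thesis by linarith
      next
        case d1: True
        have paa: "4 * (a * a) \<le> p * (a * a)" using p by (intro mult_right_mono) auto
        \<comment> \<open>When \<open>r = 2\<close> or \<open>N = 2\<close>, the quadratic term on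
          the right is smaller than the one on the left; 17 is a convenient common bound, not a
          sharp one.\<close>
        have ?thesis if "a * a \<le> 17 * a"
          using that a by simp
        moreover have "a * a \<le> 17 * a" if "r = 2"
        proof -
          have "p * (a * a) \<le> 3 * (a * a) + 12 * a + 4"
            using bound unfolding q(1) x m3 d1 that by (simp add: algebra_simps)
          then show ?thesis using paa a by linarith
        qed
        moreover have "a * a \<le> 17 * a" if "r = 3" "N = 2"
        proof -
          have "2 * (3 * (a * x) + 3 * b) \<le> 9 * (x * x)"
            using key unfolding that d1 by simp
          then have "2 * (p * (a * a)) \<le> 3 * (a * a) + 18 * a + 3"
            using mb unfolding q(1) x m3 d1 that by (simp add: algebra_simps)
          then show ?thesis using paa a by linarith
        qed
        \<comment> \<open>Here \<open>key\<close> holds for every \<open>a\<close>, so only the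
          integrality of \<open>y\<close> can give a contradiction.\<close>
        moreover have False if rN: "r = 3" "N = 1"
        proof -
          have "3 * (b + a - 1) = p * (a * a)"
            using mb unfolding q(1) m3 rN by (simp add: algebra_simps)
          then have "3 dvd p * (a * a)" by (metis dvd_triv_left)
          then have "3 dvd a"
            using \<open>\<not> m dvd p\<close> m3 prime_dvd_mult_iff[of "3::int"] by simp
          then obtain c where c: "a = 3 * c" by blast
          have "p * x - q = p + 3" unfolding q(1) x m3 d1 by (simp add: distrib_left)
          then have 1: "(p + 3) dvd q * x + 1" using div rN by (simp add: dvd_eq_mod_eq_0)
          have "p = 4 \<or> p = 5" using p \<open>\<not> 7 \<le> p\<close> by linarith
          then show False
          proof
            assume p4: "p = 4"
            have "q * x + 1 = 36 * (c * c) + 3 * c - 2"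
              unfolding q(1) x m3 d1 c p4 by (simp add: algebra_simps)
            then have "7 dvd 36 * (c * c) + 3 * c - 2"
              using 1 unfolding p4 by (simp only:) simp
            then show False using not_7_dvd by blast
          next
            assume p5: "p = 5"
            have "q * x + 1 = 45 * (c * c) + 6 * c - 2"
              unfolding q(1) x m3 d1 c p5 by (simp add: algebra_simps)
            then have "8 dvd 45 * (c * c) + 6 * c - 2"
              using 1 unfolding p5 by (simp only:) simp
            then show False using not_8_dvd by blast
          qed
        qed
        moreover have "r = 2 \<or> (r = 3 \<and> N = 2) \<or> (r = 3 \<and> N = 1)"
          using r N \<open>N < r\<close> m3 by linarith
        ultimately show ?thesis by blast
      qed
    qed
    moreover have "p \<le> 19"
    proof (cases "7 \<le> p")
      case True
      then have "(p - 6) * 2 \<le> (p - 6) * a" using a by (intro mult_left_mono) auto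
      also note 6
      finally show ?thesis by simp
    qed simp
    ultimately show ?thesis using 6 by blast
  qed
  ultimately show False using m' by (meson not_le)
qed

section \<open>\<open>Upsilon\<close> and the greedy terms of a fraction\<close>

text \<open>Two admissible values differ by a multiple of \<open>p\<close>, so only one lies in
  {1,...,p}.\<close>

lemma Upsilon_eqI:
  assumes "0 < m" "m \<le> p" "p dvd q + m"
  shows "Upsilon p q = m"
  unfolding Upsilon_def
proof (rule Least_equality)
  fix n assume n: "0 < n \<and> p dvd q + n"
  show "m \<le> n"
  proof (rule ccontr)
    assume "\<not> m \<le> n"
    then have "p dvd m - n"
      using dvd_diff_nat[of p "q + m" "q + n"] n assms by simp
    then show False using \<open>\<not> m \<le> n\<close> n assms(2) by (auto dest: dvd_imp_le)
  qed
qed (use assms in simp)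

lemma Upsilon_props:
  assumes "0 < p"
  shows "0 < Upsilon p q" "Upsilon p q \<le> p" "p dvd q + Upsilon p q"
proof -
  let ?m = "p - q mod p"
  have "q + ?m = (q - q mod p) + p"
    using assms mod_less_divisor[OF assms, of q] mod_less_eq_dividend[of q p] by linarith
  then have "p dvd q + ?m"
    by (metis dvd_add dvd_minus_mod dvd_refl)
  moreover have "0 < ?m" using assms by simp
  ultimately have "Upsilon p q = ?m" by (intro Upsilon_eqI) auto
  then show "0 < Upsilon p q" "Upsilon p q \<le> p" "p dvd q + Upsilon p q"
    using \<open>0 < ?m\<close> \<open>p dvd q + ?m\<close> by auto
qed

lemma greedy_1: "greedy \<theta> 1 = G \<theta>"
  by (subst greedy.simps) simp

lemma greedy_2: "greedy \<theta> 2 = G (\<theta> - 1 / real (greedy \<theta> 1))"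
proof -
  have "{1..<2::nat} = {1}" by auto
  then show ?thesis by (subst greedy.simps) simp
qed

lemma G_divide:
  assumes "0 < s" "0 < t"
  shows "G (real s / real t) = t div s + 1"
  unfolding G_def using assms by (simp add: floor_divide_of_nat_eq)

text \<open>From \<open>p (a - 1) <= q < p a\<close> the first term is \<open>a\<close>; the
  remainder \<open>p/q - 1/a\<close> equals \<open>m / (q a)\<close>.\<close>

lemma greedy_fraction:
  assumes "0 < m" "m \<le> p" "0 < q" "q + m = p * a"
  shows "greedy (real p / real q) 1 = a" "greedy (real p / real q) 2 = q * a div m + 1"
proof -
  have "a \<noteq> 0" using assms by (cases a) auto
  then obtain c where c: "a = Suc c" by (cases a) auto
  have "q div p = c"
  proof (rule div_nat_eqI)
    show "p * c \<le> q" using assms c by simp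
    show "q < p * Suc c" using assms c by simp
  qed
  then show 1: "greedy (real p / real q) 1 = a"
    using assms c by (simp only: greedy_1) (simp add: G_divide)
  have "real q + real m = real p * real a"
    using assms(4) by (metis of_nat_add of_nat_mult)
  then have "real p / real q - 1 / real a = real m / real (q * a)"
    using assms \<open>a \<noteq> 0\<close> by (simp add: field_simps)
  then show "greedy (real p / real q) 2 = q * a div m + 1"
    using assms \<open>a \<noteq> 0\<close> by (simp only: greedy_2 1) (subst G_divide, auto)
qed

section \<open>Fractions on which the greedy algorithm fails\<close>

text \<open>Clears denominators, so that a concrete witness is checked by arithmetic on
  naturals.\<close>

lemma greedy_not_bestI:
  assumes "0 < k" "k \<le> p" "0 < q" "q + k = p * a" "b = q * a div k + 1" "0 < x" "0 < y"
    and "q * (x + y) < p * x * y" "x * y * (a + b) < a * b * (x + y)"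
  shows "0 < p \<and> Upsilon p q = k \<and> \<not> greedy_best_two_term (real p / real q)"
proof -
  have "a \<noteq> 0" using assms by (cases a) auto
  have 1: "1 / real x + 1 / real y < real p / real q"
    using assms(3,6,7) of_nat_less_iff[where ?'a=real, THEN iffD2, OF assms(8)]
    by (simp add: field_simps)
  have "0 < b" using assms by simp
  then have 2: "1 / real a + 1 / real b < 1 / real x + 1 / real y"
    using assms(6,7) \<open>a \<noteq> 0\<close> of_nat_less_iff[where ?'a=real, THEN iffD2, OF assms(9)]
    by (simp add: field_simps)
  have "\<not> greedy_best_two_term (real p / real q)"
    unfolding greedy_best_two_term_def greedy_fraction[OF assms(1-4)] assms(5)[symmetric]
    using 1 2 assms(6,7) by force
  moreover have "p dvd q + k" using assms by simp
  ultimately show ?thesis using Upsilon_eqI assms by auto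
qed

lemma greedy_not_best_exists:
  assumes "4 \<le> k"
  shows "\<exists>p q. 0 < p \<and> p < q \<and> Upsilon p q = k \<and> \<not> greedy_best_two_term (real p / real q)"
proof -
  have wit: "\<exists>p q. 0 < p \<and> p < q \<and> Upsilon p q = k \<and> \<not> greedy_best_two_term (real p / real q)"
    if "p < q" "0 < k" "k \<le> p" "q + k = p * a" "b = q * a div k + 1" "0 < x" "0 < y"
      "q * (x + y) < p * x * y" "x * y * (a + b) < a * b * (x + y)" for p q a b x y
    using greedy_not_bestI[OF that(2,3) _ that(4-9)] that(1) by (metis less_nat_zero_code neq0_conv)
  have "k = 4 \<or> k = 5 \<or> k = 6 \<or> k = 7 \<or> k = 8 \<or> k = 9 \<or> k = 10 \<or> k = 11 \<or> 12 \<le> k"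
    using assms by linarith
  then consider "k = 4" | "k = 5" | "k = 6" | "k = 7" | "k = 8" | "k = 9" | "k = 10" | "k = 11"
    | "12 \<le> k" by metis
  then show ?thesis
  proof cases
    \<comment> \<open>The arguments are \<open>p q a b x y\<close>; here 1/3 + 1/9 < 1/4 + 1/5 <
      5/11.\<close>
    case 1 show ?thesis by (rule wit[of 5 11 3 9 4 5]) (simp_all add: 1)
  next
    case 2 show ?thesis by (rule wit[of 6 49 9 89 13 22]) (simp_all add: 2)
  next
    case 3 show ?thesis by (rule wit[of 7 43 7 51 10 16]) (simp_all add: 3)
  next
    case 4 show ?thesis by (rule wit[of 9 29 4 17 6 7]) (simp_all add: 4)
  next
    case 5 show ?thesis by (rule wit[of 9 37 5 24 7 10]) (simp_all add: 5)
  next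
    case 6 show ?thesis by (rule wit[of 10 41 5 23 6 13]) (simp_all add: 6)
  next
    case 7 show ?thesis by (rule wit[of 11 45 5 23 6 13]) (simp_all add: 7)
  next
    case 8 show ?thesis by (rule wit[of 12 49 5 23 6 13]) (simp_all add: 8)
  next
    case 9
    \<comment> \<open>The ceiling of \<open>19 k / 9\<close>. It stays below \<open>11 k / 5\<close>
      because the gap \<open>4 k / 45\<close> exceeds 1 for \<open>k >= 12\<close>.\<close>
    define p where "p = (19 * k + 8) div 9"
    define q where "q = 3 * p - k"
    have p: "19 * k \<le> 9 * p" "5 * p < 11 * k" using 9 unfolding p_def by linarith+
    have q: "q + k = p * 3" "p < q" using p 9 unfolding q_def by linarith+
    \<comment> \<open>This yields \<open>b >= 17\<close>; as 11/28 - 1/3 = 5/84 > 1/17, the greedy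
      sum falls below 1/4 + 1/7.\<close>
    have "16 * k \<le> q * 3" using p q by linarith
    then have b: "16 \<le> q * 3 div k"
      using 9 by (simp add: less_eq_div_iff_mult_less_eq)
    show ?thesis
      by (rule wit[of p q 3 _ 4 7]) (use p q b 9 in auto)
  qed
qed

section \<open>The exceptional fraction 10/17\<close>

text \<open>\<open>x = 1\<close> overshoots and \<open>x >= 4\<close> gives at most 1/2; for
  \<open>x = 2\<close> and \<open>x = 3\<close> the least admissible \<open>y\<close>, namely 12 and
  4, both give 7/12.\<close>

lemma ten_seventeenths:
  assumes "0 < x" "x \<le> y" "1 / real x + 1 / real y < 10 / 17"
  shows "1 / real x + 1 / real y \<le> 7 / 12"
    and "1 / real x + 1 / real y = 7 / 12 \<Longrightarrow> (x, y) = (2, 12) \<or> (x, y) = (3, 4)"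
proof -
  have "1 / real x + 1 / real y \<le> 7 / 12 \<and>
    (1 / real x + 1 / real y = 7 / 12 \<longrightarrow> (x, y) = (2, 12) \<or> (x, y) = (3, 4))"
  proof -
    have "x = 1 \<or> x = 2 \<or> x = 3 \<or> 4 \<le> x" using assms by linarith
    then consider "x = 1" | "x = 2" | "x = 3" | "4 \<le> x" by metis
    then show ?thesis
    proof cases
      case 1
      then show ?thesis using assms(1,2,3) by (simp add: field_simps)
    next
      case 2
      then have "34 < 3 * real y" using assms by (simp add: field_simps)
      then have "12 \<le> y" by linarith
      then show ?thesis using 2 by (simp add: field_simps)
    next
      case 3
      then have "51 < 13 * real y" using assms by (simp add: field_simps)
      then have "4 \<le> y" by linarith
      then show ?thesis using 3 by (simp add: field_simps)
    next
      case 4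
      have "1 / real x \<le> 1 / 4" "1 / real y \<le> 1 / 4"
        using 4 assms by (simp_all add: field_simps)
      then show ?thesis by linarith
    qed
  qed
  then show "1 / real x + 1 / real y \<le> 7 / 12"
    "1 / real x + 1 / real y = 7 / 12 \<Longrightarrow> (x, y) = (2, 12) \<or> (x, y) = (3, 4)" by blast+
qed


section \<open>Uniqueness away from 10/17\<close>

text \<open>A first term \<open>x < a\<close> overshoots, \<open>x > a\<close> is excluded by
  \<open>no_better_int\<close>, and \<open>x = a\<close> forces \<open>y = b\<close>.\<close>

lemma greedy_unique_best_aux:
  fixes p q m a :: nat
  assumes m: "1 \<le> m" "m \<le> 3" "m = 1 \<or> \<not> m dvd p" "m \<le> p"
    and q: "q + m = p * a" "p < q" and exc: "\<not> (m = 3 \<and> p = 10 \<and> a = 2)"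
  shows "greedy_unique_best_two_term (real p / real q)"
proof -
  define b where "b = q * a div m + 1"
  have q0: "0 < q" and m0: "0 < m" using q m by auto
  have gr: "greedy (real p / real q) 1 = a" "greedy (real p / real q) 2 = b"
    using greedy_fraction[OF m0 m(4) q0 q(1)] by (simp_all add: b_def)
  have a0: "0 < a" and b0: "0 < b" using q by (auto simp: b_def intro: Nat.gr0I)
  have uniq: "x = a \<and> y = b"
    if xy: "0 < x" "x \<le> y" and le: "1 / real a + 1 / real b \<le> 1 / real x + 1 / real y"
      and lt: "1 / real x + 1 / real y < real p / real q" for x y
  proof -
    have y0: "0 < y" using xy by simp
    have "real (q * (x + y)) < real (p * x * y)"
      using lt xy(1) y0 q0 by (simp add: field_simps)
    then have lt': "q * (x + y) < p * x * y" by (simp only: of_nat_less_iff)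
    have "real (x * y * (a + b)) \<le> real (a * b * (x + y))"
      using le xy(1) y0 a0 b0 by (simp add: field_simps)
    then have le': "x * y * (a + b) \<le> a * b * (x + y)" by (simp only: of_nat_le_iff)
    \<comment> \<open>Already \<open>1/x < p/q\<close> forces \<open>x >= a\<close>, since
      \<open>p (a - 1) <= q\<close>.\<close>
    have "q * y < p * x * y" using lt' unfolding distrib_left by linarith
    then have "q < p * x" using y0 by simp
    then have "p * a < p * (x + 1)" using q m by simp
    then have "a \<le> x" by (simp only: mult_less_cancel1) simp
    moreover have "\<not> a < x"
    proof
      assume "a < x"
      have "int q = int p * int a - int m" using q by (simp flip: of_nat_mult of_nat_add)
      moreover have "int b = int q * int a div int m + 1" by (simp add: b_def zdiv_int)
      moreover have "int q * (int x + int y) < int p * int x * int y"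
        using lt' by (simp flip: of_nat_mult of_nat_add)
      moreover have "int x * int y * (int a + int b) \<le> int a * int b * (int x + int y)"
        using le' by (simp flip: of_nat_mult of_nat_add)
      ultimately show False
        using no_better_int[of "int m" "int p" "int q" "int a" "int b" "int x" "int y"]
          m q(2) exc xy(2) \<open>a < x\<close> by auto
    qed
    ultimately have xa: "x = a" by simp
    have "y \<le> b" using le y0 b0 unfolding xa by (simp add: field_simps)
    \<comment> \<open>With \<open>x = a\<close> the strict bound reads
      \<open>1/y < m / (q a)\<close>, so \<open>y >= b\<close>.\<close>
    have "q * a + q * y < (q + m) * y" using lt' unfolding xa q(1) by (simp add: algebra_simps)
    then have "q * a < m * y" by (simp add: algebra_simps)
    then have "q * a div m < y" using m0 by (simp add: div_less_iff_less_mult mult.commute)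
    then show ?thesis using xa \<open>y \<le> b\<close> b_def by simp
  qed
  have best: "greedy_best_two_term (real p / real q)"
    unfolding greedy_best_two_term_def gr
  proof (intro allI impI, elim conjE)
    fix x y :: nat
    assume x: "0 < x" "0 < y" "1 / real x + 1 / real y < real p / real q"
    show "1 / real x + 1 / real y \<le> 1 / real a + 1 / real b"
      \<comment> \<open>A strictly better pair, put in increasing order, would be identified with
        \<open>(a, b)\<close> by \<open>uniq\<close>.\<close>
      using uniq[of x y] uniq[of y x] x by (cases "x \<le> y") (force simp: add.commute)+
  qed
  show ?thesis
    unfolding greedy_unique_best_two_term_def gr using best uniq by auto
qed

text \<open>The greedy terms depend only on the quotient. If \<open>m > 1\<close> divides
  \<open>p\<close>, it divides \<open>q\<close> too, and after cancelling it the value 1 takes the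
  place of \<open>m\<close>.\<close>

lemma greedy_unique_best:
  fixes p q :: nat
  assumes "0 < p" "p < q" "Upsilon p q \<le> 3" "real p / real q \<noteq> 10 / 17"
  shows "greedy_unique_best_two_term (real p / real q)"
proof -
  define m where "m = Upsilon p q"
  have m: "0 < m" "m \<le> p" "p dvd q + m" "m \<le> 3"
    using Upsilon_props[OF assms(1), of q] assms(3) by (simp_all add: m_def)
  then obtain a where a: "q + m = p * a" by blast
  show ?thesis
  proof (cases "m = 1 \<or> \<not> m dvd p")
    case True
    have "\<not> (m = 3 \<and> p = 10 \<and> a = 2)"
    proof
      assume "m = 3 \<and> p = 10 \<and> a = 2"
      then show False using a assms(4) by simp
    qed
    then show ?thesis using greedy_unique_best_aux[of m p q a] True m a assms(2) by simp
  next
    case False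
    then obtain p' where p': "p = m * p'" by blast
    have "m dvd q" using a unfolding p' by (metis dvd_add_left_iff dvd_refl dvd_mult2 dvd_triv_left)
    then obtain q' where q': "q = m * q'" by blast
    have "m * (q' + 1) = m * (p' * a)" using a unfolding p' q' by (simp add: algebra_simps)
    then have "q' + 1 = p' * a" using m by (metis mult_cancel1 neq0_conv)
    moreover have "p' < q'" "1 \<le> p'" using assms(1,2) m unfolding p' q' by auto
    moreover have "real p / real q = real p' / real q'" using m unfolding p' q' by simp
    ultimately show ?thesis using greedy_unique_best_aux[of 1 p' q' a] by simp
  qed
qed

theorem theorem1p3:
  "(\<forall>p q :: nat. 0 < p \<and> p < q \<and> Upsilon p q \<le> 3 \<and> real p / real q \<noteq> 10 / 17 \<longrightarrow>
      greedy_unique_best_two_term (real p / real q)) \<and>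
   (\<forall>p q :: nat. 0 < p \<and> p < q \<and> real p / real q = 10 / 17 \<longrightarrow>
      greedy_best_two_term (real p / real q) \<and>
      \<not> greedy_unique_best_two_term (real p / real q) \<and>
      greedy (real p / real q) 1 = 2 \<and> greedy (real p / real q) 2 = 12 \<and>
      {(x1 :: nat, x2 :: nat). 0 < x1 \<and> x1 \<le> x2 \<and> (x1, x2) \<noteq> (2, 12) \<and>
          1 / real x1 + 1 / real x2 < real p / real q \<and>
          1 / real x1 + 1 / real x2 = 1 / 2 + 1 / 12} = {(3, 4)}) \<and>
   (\<forall>k :: nat. 4 \<le> k \<longrightarrow>
      (\<exists>p q :: nat. 0 < p \<and> p < q \<and> Upsilon p q = k \<and>
        \<not> greedy_best_two_term (real p / real q)))"
proof (intro conjI allI impI)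
  fix p q :: nat
  assume "0 < p \<and> p < q \<and> real p / real q = 10 / 17"
  then have pq: "real p / real q = 10 / 17" by simp
  \<comment> \<open>Here \<open>17 + 3 = 10 * 2\<close>, and the second term is
    \<open>34 div 3 + 1\<close>.\<close>
  have gr: "greedy (10 / 17) 1 = 2" "greedy (10 / 17) 2 = 12"
    using greedy_fraction[of 3 10 17 2] by simp_all
  show "greedy (real p / real q) 1 = 2" "greedy (real p / real q) 2 = 12"
    using gr by (simp_all add: pq)
  show "greedy_best_two_term (real p / real q)"
    unfolding greedy_best_two_term_def pq gr
  proof (intro allI impI, elim conjE)
    fix x y :: nat
    assume "0 < x" "0 < y" "1 / real x + 1 / real y < 10 / 17"
    then show "1 / real x + 1 / real y \<le> 1 / real 2 + 1 / real 12"
      using ten_seventeenths(1)[of x y] ten_seventeenths(1)[of y x]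
      by (cases "x \<le> y") (simp_all add: add.commute)
  qed
  show "\<not> greedy_unique_best_two_term (real p / real q)"
    unfolding greedy_unique_best_two_term_def pq gr
    \<comment> \<open>The pair (3, 4) attains the greedy sum 7/12.\<close>
    by (intro notI, elim conjE allE[of _ 3] allE[of _ 4]) simp
  show "{(x1 :: nat, x2 :: nat). 0 < x1 \<and> x1 \<le> x2 \<and> (x1, x2) \<noteq> (2, 12) \<and>
          1 / real x1 + 1 / real x2 < real p / real q \<and>
          1 / real x1 + 1 / real x2 = 1 / 2 + 1 / 12} = {(3, 4)}"
    unfolding pq using ten_seventeenths(2) by auto
qed (use greedy_unique_best greedy_not_best_exists in blast)+

end
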